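(* Let $n\ge 0$ be an integer, let $a\ge 2$ be an integer, and let $b_0,b_1,\dots,b_n$ be positive integers, none of which is a multiple of $a$. Suppose that $a$ and $b_0$ are coprime. For $1\le i\le n$, let $l_i$ be the integer such that $1\le l_i\le a-1$ and $a\mid b_0l_i+b_i$. Then there is a bijection between the set of $(a,b_0,b_1,\dots,b_n)$-core partitions and the set of all tuples $(z_0,\dots,z_{a-1})\in\mathbb{N}^a$ such that $$\sum_{m=0}^{a-1}z_m=b_0,\qquad a\;\Big|\;\sum_{m=0}^{a-1}mz_m,\qquad\text{and}\qquad \sum_{m=j}^{j+l_i-1}z_m\le \frac{b_0l_i+b_i}{a}\ \text{ for all } 1\le i\le n \text{ and } 0\le j\le a-1,$$ where indices of $z$ are interpreted modulo $a$. In particular, the number of $(a,b_0,b_1,\dots,b_n)$-core partitions is $$\frac1a\left|\left\{(z_0,\dots,z_{a-1})\in\mathbb{N}^a:\ \sum_{m=0}^{a-1}z_m=b_0 \text{ and } \sum_{m=j}^{j+l_i-1}z_m\le \frac{b_0l_i+b_i}{a}\text{ for all } 1\le i\le n,\ 0\le j\le a-1\right\}\right|.$$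
   Context: $\mathbb{N}$ denotes the set of non-negative integers. A partition is a finite non-increasing sequence of positive integers (the empty partition is allowed). The hook length of a cell of the Ferrers diagram of a partition is the number of cells in its arm plus the number in its leg plus one. A partition is an $a$-core if no cell of its Ferrers diagram has hook length divisible by $a$; it is an $(a_1,\dots,a_n)$-core if it is simultaneously an $a_i$-core for every $i$. *)

theory Defs
  imports Complex_Main
begin

type_synonym cell = "nat \<times> nat"

definition is_partition :: "nat list \<Rightarrow> bool" where
  "is_partition p \<longleftrightarrow> sorted_wrt (\<ge>) p \<and> (\<forall>x\<in>set p. 0 < x)"

text \<open>Rows and columns of the Ferrers diagram are numbered from 0; row \<open>r\<close> has \<open>p ! r\<close> cells.\<close>

definition ferrers :: "nat list \<Rightarrow> cell set" where
  "ferrers p = {(r, c). r < length p \<and> c < p ! r}"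

definition arm :: "nat list \<Rightarrow> cell \<Rightarrow> cell set" where
  "arm p = (\<lambda>(r, c). {(r', c') \<in> ferrers p. r' = r \<and> c < c'})"

definition leg :: "nat list \<Rightarrow> cell \<Rightarrow> cell set" where
  "leg p = (\<lambda>(r, c). {(r', c') \<in> ferrers p. c' = c \<and> r < r'})"

definition hook_length :: "nat list \<Rightarrow> cell \<Rightarrow> nat" where
  "hook_length p x = card (arm p x) + card (leg p x) + 1"

definition is_core :: "nat \<Rightarrow> nat list \<Rightarrow> bool" where
  "is_core a p \<longleftrightarrow> is_partition p \<and> (\<forall>x\<in>ferrers p. \<not> a dvd hook_length p x)"

definition core_partitions :: "nat set \<Rightarrow> nat list set" where
  "core_partitions S = {p. is_partition p \<and> (\<forall>s\<in>S. is_core s p)}"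

text \<open>
  A tuple \<open>(z\<^sub>0, \<dots>, z\<^bsub>a-1\<^esub>)\<close> of naturals is a list of length \<open>a\<close>. The parameters with index
  \<open>i \<notin> {1..n}\<close>, except \<open>b 0\<close>, are irrelevant. The definition is meant for \<open>l\<close> such that \<open>a\<close> divides
  \<open>b 0 * l i + b i\<close> for each \<open>i \<in> {1..n}\<close>, so that the division is exact.
\<close>

definition bounded_tuples ::
    "nat \<Rightarrow> nat \<Rightarrow> (nat \<Rightarrow> nat) \<Rightarrow> (nat \<Rightarrow> nat) \<Rightarrow> nat list set" where
  "bounded_tuples a n b l =
    {z. length z = a
      \<and> (\<Sum>m<a. z ! m) = b 0
      \<and> (\<forall>i\<in>{1..n}. \<forall>j<a.
            (\<Sum>m = j..<j + l i. z ! (m mod a)) \<le> (b 0 * l i + b i) div a)}"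

end

theory Submission
  imports Defs "HOL-Number_Theory.Cong"
begin

text \<open>
  A partition is determined by the finite set of hook lengths in its first column, and it is an
  \<open>s\<close>-core iff the complement \<open>K\<close> of this set is closed under adding \<open>s\<close>. When \<open>K\<close> is closed under
  adding \<open>a\<close>, it is determined by its least elements \<open>y\<^sub>j\<close> in the classes of \<open>j b\<^sub>0\<close> modulo \<open>a\<close>. Put
  \<open>a z\<^sub>j = y\<^sub>j + b\<^sub>0 - y\<^bsub>j+1\<^esub>\<close>. Being closed under \<open>b\<^sub>0\<close> means \<open>z\<^sub>j \<ge> 0\<close>; being closed under \<open>b\<^sub>i\<close> means
  \<open>y\<^sub>j \<le> y\<^bsub>j+l\<^esub> + b\<^sub>i\<close> with \<open>l = l\<^sub>i\<close>, which is the bound on sums of \<open>l\<close> consecutive \<open>z\<^sub>m\<close>; and \<open>y\<^sub>0 = 0 \<le> y\<^sub>j\<close> is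
  a ballot condition on the partial sums of \<open>z\<close>. So the cores correspond to the bounded ballot tuples.
  The bounded tuples are closed under rotation. Among the \<open>a\<close> rotations of a tuple exactly one is
  ballot, by the cycle lemma, and exactly one satisfies the divisibility condition, since a rotation by
  one place changes \<open>\<Sum>\<^sub>m m z\<^sub>m\<close> by \<open>b\<^sub>0\<close> modulo \<open>a\<close>. Hence both kinds of tuples make up a fraction \<open>1/a\<close>
  of all bounded tuples.
\<close>

section \<open>Cores and first-column hooks\<close>

text \<open>The first cell of a row of length \<open>x\<close> above the rows \<open>p\<close> has
  arm \<open>x - 1\<close> and leg \<open>length p\<close>. The resulting set is also known as the
  beta-set of the partition.\<close>

fun first_column_hooks :: "nat list \<Rightarrow> nat set" where
  "first_column_hooks [] = {}"
| "first_column_hooks (x # p) = insert (x + length p) (first_column_hooks p)"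

text \<open>Number the steps of the boundary path from its lower left end by 0, 1, 2 and so on.
  Vertical steps carry the first-column hooks; \<open>gap p c\<close> is the number of the
  horizontal step at column \<open>c\<close>, which follows \<open>c\<close> horizontal steps and
  one vertical step for each row of length at most \<open>c\<close>.\<close>

definition gap :: "nat list \<Rightarrow> nat \<Rightarrow> nat" where
  "gap p c = c + length (filter (\<lambda>x. x \<le> c) p)"

lemma is_partition_Nil [simp]: "is_partition []"
  by (simp add: is_partition_def)

lemma is_partition_Cons:
  "is_partition (x # p) \<longleftrightarrow> 0 < x \<and> (\<forall>y\<in>set p. y \<le> x) \<and> is_partition p"
  by (auto simp: is_partition_def)

lemma finite_first_column_hooks [simp]: "finite (first_column_hooks p)"
  by (induction p) auto

lemma first_column_hooks_conv_nth:
  "first_column_hooks p = (\<lambda>r. p ! r + (length p - Suc r)) ` {..<length p}"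
proof (induction p)
  case (Cons x p)
  have "(\<lambda>r. (x # p) ! r + (length (x # p) - Suc r)) ` {..<length (x # p)} =
      insert (x + length p) ((\<lambda>r. p ! r + (length p - Suc r)) ` {..<length p})"
    unfolding list.size add_Suc_right add_0_right lessThan_Suc_eq_insert_0 by (simp add: image_image)
  with Cons show ?case by simp
qed simp

lemma strict_mono_gap: "strict_mono (gap p)"
  unfolding strict_mono_Suc_iff
proof
  fix c
  have "length (filter (\<lambda>x. x \<le> c) p) \<le> length (filter (\<lambda>x. x \<le> Suc c) p)"
    by (induction p) auto
  thus "gap p c < gap p (Suc c)" by (simp add: gap_def)
qed

text \<open>A new top row of length \<open>x\<close> turns the gap
  \<open>gap p x = x + length p\<close> into a hook; earlier gaps stay, and later ones move down one
  place in the numbering.\<close>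

lemma Compl_first_column_hooks:
  "is_partition p \<Longrightarrow> - first_column_hooks p = range (gap p)"
proof (induction p)
  case Nil
  show ?case by (auto simp: gap_def)
next
  case (Cons x p)
  hence le: "\<And>y. y \<in> set p \<Longrightarrow> y \<le> x" and IH: "- first_column_hooks p = range (gap p)"
    by (auto simp: is_partition_Cons)
  have below: "gap (x # p) c = gap p c" if "c < x" for c
    using that by (simp add: gap_def)
  have above: "gap p c = c + length p" if "x \<le> c" for c
    using that le by (fastforce simp: gap_def intro!: arg_cong[of _ _ length] filter_True)
  have above': "gap (x # p) c = gap p (Suc c)" if "x \<le> c" for c
    using that above[of c] above[of "Suc c"] by (simp add: gap_def)
  have "range (gap (x # p)) = gap p ` (- {x})" (is "?L = ?R")
  proof
    show "?L \<subseteq> ?R"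
    proof
      fix y assume "y \<in> ?L"
      then obtain c where c: "y = gap (x # p) c" by blast
      show "y \<in> ?R"
        using c below[of c] above'[of c]
        by (cases "c < x") auto
    qed
    have "gap p c \<in> ?L" if "c \<noteq> x" for c
    proof (cases "c < x")
      case True
      thus ?thesis using below by (metis rangeI)
    next
      case False
      with that obtain d where "c = Suc d" "x \<le> d" by (cases c) auto
      thus ?thesis using above' by (metis rangeI)
    qed
    thus "?R \<subseteq> ?L" by auto
  qed
  also have "\<dots> = range (gap p) - {gap p x}"
    using strict_mono_imp_inj_on[OF strict_mono_gap, of p] by (auto simp: inj_def)
  finally show ?case using IH above[of x] by auto
qed

text \<open>Since \<open>c < p ! r\<close>, every row of length at most \<open>c\<close> lies below
  row \<open>r\<close>. These rows and those met by the leg make up all rows below \<open>r\<close>,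
  so the hook length is a first-column hook minus a gap.\<close>

lemma hook_length_plus_gap:
  assumes "is_partition p" "r < length p" "c < p ! r"
  shows "hook_length p (r, c) + gap p c = p ! r + (length p - Suc r)"
proof -
  have mono: "p ! r' \<ge> p ! r" if "r' \<le> r" for r'
    using assms that unfolding is_partition_def
    by (cases "r' = r") (auto simp: sorted_wrt_iff_nth_less)
  have "arm p (r, c) = Pair r ` {c<..<p ! r}"
    using assms by (auto simp: arm_def ferrers_def)
  hence arm: "card (arm p (r, c)) = p ! r - Suc c"
    by (simp add: card_image inj_on_def)
  have "leg p (r, c) = (\<lambda>r'. (r', c)) ` {r'. r < r' \<and> r' < length p \<and> c < p ! r'}"
    using assms by (auto simp: leg_def ferrers_def)
  hence "card (leg p (r, c)) = card {r'. r < r' \<and> r' < length p \<and> c < p ! r'}" (is "_ = card ?A")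
    by (simp add: card_image inj_on_def)
  moreover have "card ?A + card {r'. r' < length p \<and> p ! r' \<le> c} = card {r<..<length p}"
  proof -
    have "r < r'" if "p ! r' \<le> c" for r'
      using mono[of r'] that assms(3) by linarith
    hence "?A \<union> {r'. r' < length p \<and> p ! r' \<le> c} = {r<..<length p}"
      by auto
    moreover have "?A \<inter> {r'. r' < length p \<and> p ! r' \<le> c} = {}"
      by auto
    ultimately show ?thesis
      by (metis (no_types, lifting) card_Un_disjoint finite_Un finite_greaterThanLessThan)
  qed
  ultimately have leg:
    "card (leg p (r, c)) + length (filter (\<lambda>x. x \<le> c) p) = length p - Suc r"
    by (simp add: length_filter_conv_card)
  show ?thesis
    using arm leg assms(3) by (simp add: hook_length_def gap_def)
qed

text \<open>The rows from \<open>r\<close> on all have length at most \<open>c\<close> and are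
  counted by the gap. Hence a gap below the hook of row \<open>r\<close> always comes from a column
  meeting that row.\<close>

lemma first_column_hook_less_gap:
  assumes "is_partition p" "r < length p" "p ! r \<le> c"
  shows "p ! r + (length p - Suc r) < gap p c"
proof -
  have "p ! r' \<le> c" if "r \<le> r'" "r' < length p" for r'
  proof -
    have "p ! r' \<le> p ! r"
      using assms(1) that unfolding is_partition_def
      by (cases "r' = r") (auto simp: sorted_wrt_iff_nth_less)
    with assms(3) show ?thesis by simp
  qed
  hence "card {r..<length p} \<le> card {r'. r' < length p \<and> p ! r' \<le> c}"
    by (intro card_mono) auto
  thus ?thesis
    using assms by (simp add: gap_def length_filter_conv_card)
qed

text \<open>The hook lengths are exactly the positive differences of a first-column hook and a
  gap.\<close>

lemma is_core_iff_hooks: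
  assumes "is_partition p"
  shows "is_core s p \<longleftrightarrow>
    (\<forall>x\<in>first_column_hooks p. \<forall>g. g \<notin> first_column_hooks p \<longrightarrow> g < x \<longrightarrow> \<not> s dvd x - g)"
    (is "_ \<longleftrightarrow> ?R")
proof
  assume core: "is_core s p"
  show ?R
  proof (intro ballI allI impI)
    fix x g assume x: "x \<in> first_column_hooks p" and "g \<notin> first_column_hooks p" and less: "g < x"
    then obtain c where c: "g = gap p c"
      using Compl_first_column_hooks[OF assms] by blast
    obtain r where r: "r < length p" "x = p ! r + (length p - Suc r)"
      using x by (auto simp: first_column_hooks_conv_nth)
    have "c < p ! r"
      using first_column_hook_less_gap[OF assms r(1), of c] less c r by linarith
    moreover from this have "x - g = hook_length p (r, c)"
      using hook_length_plus_gap[OF assms r(1)] c r(2) by (metis add_diff_cancel_right')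
    ultimately show "\<not> s dvd x - g"
      using core r(1) by (auto simp: is_core_def ferrers_def)
  qed
next
  assume R: ?R
  have "\<not> s dvd hook_length p (r, c)" if rc: "r < length p" "c < p ! r" for r c
  proof -
    note eq = hook_length_plus_gap[OF assms rc]
    have "p ! r + (length p - Suc r) \<in> first_column_hooks p"
      using rc(1) unfolding first_column_hooks_conv_nth by blast
    moreover have "gap p c \<notin> first_column_hooks p"
      using Compl_first_column_hooks[OF assms] by blast
    moreover have "0 < hook_length p (r, c)"
      by (simp add: hook_length_def)
    ultimately show ?thesis
      using R eq by (metis add_diff_cancel_right' less_add_same_cancel2)
  qed
  thus "is_core s p"
    using assms by (auto simp: is_core_def ferrers_def)
qed

text \<open>A positive difference \<open>s * t\<close> between a hook and a gap is covered by
  \<open>t\<close> steps of length \<open>s\<close>, one of which must leave the set of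
  gaps.\<close>

lemma is_core_iff_closed:
  assumes "is_partition p" "0 < s"
  shows "is_core s p \<longleftrightarrow> (\<forall>g. g \<notin> first_column_hooks p \<longrightarrow> g + s \<notin> first_column_hooks p)"
    (is "_ \<longleftrightarrow> ?R")
proof
  assume "is_core s p"
  show ?R
  proof (intro allI impI notI)
    fix g assume "g \<notin> first_column_hooks p" "g + s \<in> first_column_hooks p"
    moreover have "g < g + s" "s dvd g + s - g"
      using assms(2) by simp_all
    ultimately show False
      using \<open>is_core s p\<close> is_core_iff_hooks[OF assms(1)] by blast
  qed
next
  assume R: ?R
  have "g + s * t \<notin> first_column_hooks p" if "g \<notin> first_column_hooks p" for g t
  proof (induction t)
    case (Suc t)
    thus ?case using R[rule_format, of "g + s * t"] by (simp add: algebra_simps)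
  qed (use that in simp)
  thus "is_core s p"
    unfolding is_core_iff_hooks[OF assms(1)]
    by (metis dvd_def le_add_diff_inverse less_imp_le)
qed

section \<open>Partitions as finite sets of positive integers\<close>

lemma first_column_hooks_less:
  "is_partition (x # p) \<Longrightarrow> y \<in> first_column_hooks p \<Longrightarrow> y < x + length p"
  by (induction p arbitrary: x) (fastforce simp: is_partition_Cons)+

text \<open>The largest hook belongs to the first row; removing it leaves the hooks of the remaining
  rows.\<close>

lemma inj_on_first_column_hooks: "inj_on first_column_hooks (Collect is_partition)"
proof (rule inj_onI, clarify)
  fix p q assume "is_partition p" "is_partition q" "first_column_hooks p = first_column_hooks q"
  thus "p = q"
  proof (induction p arbitrary: q)
    case Nil
    thus ?case by (cases q) auto
  next
    case (Cons x p)
    from Cons.prems(3) obtain y q' where q: "q = y # q'" by (cases q) auto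
    note less_p = first_column_hooks_less[OF Cons.prems(1)]
    note less_q = first_column_hooks_less[OF Cons.prems(2)[unfolded q]]
    have eq: "insert (x + length p) (first_column_hooks p) =
        insert (y + length q') (first_column_hooks q')"
      using Cons.prems(3) q by simp
    hence max: "x + length p = y + length q'"
      using less_p less_q by (metis insertE insertI1 less_asym)
    hence "first_column_hooks p = first_column_hooks q'"
      using eq less_p less_q by (metis insert_ident less_irrefl)
    hence "p = q'"
      using Cons q by (auto simp: is_partition_Cons)
    with max q show ?case by simp
  qed
qed

lemma zero_notin_first_column_hooks: "is_partition p \<Longrightarrow> 0 \<notin> first_column_hooks p"
  by (induction p) (auto simp: is_partition_Cons)

text \<open>The partition is built from the bottom row up: each new maximum \<open>m\<close> becomes
  the hook of a top row of length \<open>m - length p\<close>.\<close>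

lemma ex_partition_first_column_hooks:
  assumes "finite X" "0 \<notin> X"
  shows "\<exists>p. is_partition p \<and> first_column_hooks p = X"
  using assms
proof (induction X rule: finite_linorder_max_induct)
  case empty
  show ?case by (rule exI[of _ "[]"]) simp
next
  case (insert m X)
  then obtain p where p: "is_partition p" "first_column_hooks p = X" by auto
  \<comment> \<open>The new row is long enough because \<open>m\<close> exceeds the hook of the
    previous top row; for empty \<open>p\<close>, \<open>m\<close> is positive since the given set
    omits 0.\<close>
  have below: "length p < m \<and> (\<forall>y\<in>set p. y \<le> m - length p)"
  proof (cases p)
    case Nil
    with insert.prems show ?thesis by auto
  next
    case (Cons y q)
    hence "y + length q < m" using p insert.hyps by auto
    with Cons p(1) show ?thesis by (auto simp: is_partition_Cons)
  qed
  show ?case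
    by (rule exI[of _ "(m - length p) # p"]) (use p below in \<open>auto simp: is_partition_Cons\<close>)
qed

lemma bij_betw_core_partitions:
  assumes "0 \<notin> S"
  shows "bij_betw (\<lambda>p. - first_column_hooks p) (core_partitions S)
    {K. 0 \<in> K \<and> finite (- K) \<and> (\<forall>s\<in>S. \<forall>g\<in>K. g + s \<in> K)}" (is "bij_betw ?f _ ?R")
proof (rule bij_betw_imageI)
  have core: "p \<in> core_partitions S \<longleftrightarrow> is_partition p \<and>
      (\<forall>s\<in>S. \<forall>g. g \<notin> first_column_hooks p \<longrightarrow> g + s \<notin> first_column_hooks p)" for p
  proof -
    have "0 < s" if "s \<in> S" for s
      using that assms by (cases s) auto
    thus ?thesis
      using is_core_iff_closed[of p] by (auto simp: core_partitions_def)
  qed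
  show "inj_on ?f (core_partitions S)"
    using inj_on_first_column_hooks by (auto simp: inj_on_def core)
  show "?f ` core_partitions S = ?R"
  proof
    show "?f ` core_partitions S \<subseteq> ?R"
      using zero_notin_first_column_hooks by (auto simp: core)
    show "?R \<subseteq> ?f ` core_partitions S"
    proof
      fix K assume K: "K \<in> ?R"
      then obtain p where "is_partition p" "first_column_hooks p = - K"
        using ex_partition_first_column_hooks[of "- K"] by auto
      with K show "K \<in> ?f ` core_partitions S"
        by (intro image_eqI[of _ _ p]) (auto simp: core)
    qed
  qed
qed

section \<open>Rotations of bounded tuples\<close>

text \<open>Reading indices cyclically for every \<open>j\<close> makes each cyclic window sum a
  difference of two partial sums, without a case of wrapping around.\<close>

definition psum :: "nat list \<Rightarrow> nat \<Rightarrow> nat" where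
  "psum z j = (\<Sum>m<j. z ! (m mod length z))"

lemma psum_0 [simp]: "psum z 0 = 0"
  by (simp add: psum_def)

lemma psum_Suc [simp]: "psum z (Suc j) = psum z j + z ! (j mod length z)"
  by (simp add: psum_def)

lemma psum_length: "psum z (length z) = (\<Sum>m<length z. z ! m)"
  by (simp add: psum_def)

lemma psum_add: "psum z (j + k) = psum z j + (\<Sum>m = j..<j + k. z ! (m mod length z))"
  by (induction k) auto

lemma psum_add_length: "psum z (j + length z) = psum z j + psum z (length z)"
  by (induction j) auto

lemma psum_add_mult_length: "psum z (j + t * length z) = psum z j + t * psum z (length z)"
proof (induction t)
  case (Suc t)
  have "psum z (j + Suc t * length z) = psum z ((j + t * length z) + length z)"
    by (simp add: algebra_simps)
  thus ?case using Suc unfolding psum_add_length by simp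
qed simp

lemma psum_rotate: "z \<noteq> [] \<Longrightarrow> psum z (k + j) = psum z k + psum (rotate k z) j"
proof (induction j)
  case (Suc j)
  have "rotate k z ! (j mod length z) = z ! ((k + j) mod length z)"
    using Suc.prems by (simp add: nth_rotate mod_add_right_eq)
  with Suc show ?case by simp
qed simp

text \<open>Window sums depend only on \<open>j mod a\<close>, so \<open>j\<close> may range over
  all naturals; and a bound by \<open>q div a\<close> amounts to a bound by \<open>q\<close> after
  multiplication by \<open>a\<close>.\<close>

lemma bounded_tuples_iff:
  assumes "0 < a"
  shows "z \<in> bounded_tuples a n b l \<longleftrightarrow> length z = a \<and> psum z a = b 0 \<and>
    (\<forall>i\<in>{1..n}. \<forall>j. a * psum z (j + l i) \<le> a * psum z j + b 0 * l i + b i)"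
proof -
  have "(\<forall>j<a. (\<Sum>m = j..<j + k. z ! (m mod a)) \<le> q div a) \<longleftrightarrow>
      (\<forall>j. a * psum z (j + k) \<le> a * psum z j + q)" (is "?L \<longleftrightarrow> ?R")
    if a: "length z = a" for k q
  proof -
    let ?W = "\<lambda>j. \<Sum>m = j..<j + k. z ! (m mod a)"
    have W: "psum z (j + k) = psum z j + ?W j" for j
      using psum_add[of z j k] a by simp
    have "?W j = ?W (j mod a)" for j
    proof -
      let ?t = "j div a"
      have "psum z (j mod a + ?t * a) = psum z (j mod a) + ?t * psum z a"
        and "psum z ((j mod a + k) + ?t * a) = psum z (j mod a + k) + ?t * psum z a"
        using psum_add_mult_length[of z _ ?t] a by blast+
      moreover have "j mod a + ?t * a = j" "(j mod a + k) + ?t * a = j + k"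
        using mod_div_mult_eq[of j a] by linarith+
      ultimately have "psum z j = psum z (j mod a) + ?t * psum z a"
        and "psum z (j + k) = psum z (j mod a + k) + ?t * psum z a"
        by metis+
      with W[of j] W[of "j mod a"] show ?thesis by linarith
    qed
    hence "?L \<longleftrightarrow> (\<forall>j. ?W j \<le> q div a)"
      using assms by (metis mod_less_divisor)
    also have "\<dots> \<longleftrightarrow> ?R"
      using assms by (simp add: W less_eq_div_iff_mult_less_eq algebra_simps)
    finally show ?thesis .
  qed
  moreover have "(\<Sum>m<a. z ! m) = psum z a" if "length z = a"
    using psum_length[of z] that by simp
  ultimately show ?thesis
    unfolding bounded_tuples_def mem_Collect_eq add.assoc by metis
qed

lemma rotate_in_bounded_tuples:
  assumes "0 < a" "z \<in> bounded_tuples a n b l"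
  shows "rotate k z \<in> bounded_tuples a n b l"
proof -
  note z = assms(2)[unfolded bounded_tuples_iff[OF assms(1)]]
  with assms(1) have shift: "psum z (k + j) = psum z k + psum (rotate k z) j" for j
    by (intro psum_rotate) auto
  have "psum (rotate k z) a = b 0"
    using shift[of a] psum_add_length[of z k] z by simp
  moreover have "a * psum (rotate k z) (j + l i) \<le> a * psum (rotate k z) j + b 0 * l i + b i"
    if "i \<in> {1..n}" for i j
  proof -
    have "a * psum z (k + j + l i) \<le> a * psum z (k + j) + b 0 * l i + b i"
      using z that by blast
    thus ?thesis
      using shift[of j] shift[of "j + l i"] by (simp add: add.assoc distrib_left)
  qed
  ultimately show ?thesis
    using z by (simp add: bounded_tuples_iff[OF assms(1)])
qed

lemma finite_bounded_tuples: "finite (bounded_tuples a n b l)"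
proof (rule finite_subset)
  show "bounded_tuples a n b l \<subseteq> {z. set z \<subseteq> {..b 0} \<and> length z = a}"
  proof
    fix z assume z: "z \<in> bounded_tuples a n b l"
    have "z ! m \<le> b 0" if "m < a" for m
      using z member_le_sum[of m "{..<a}" "(!) z"] that by (simp add: bounded_tuples_def)
    with z show "z \<in> {z. set z \<subseteq> {..b 0} \<and> length z = a}"
      by (auto simp: bounded_tuples_def in_set_conv_nth)
  qed
qed (simp add: finite_lists_length_eq)

section \<open>Distinguished rotations and their number\<close>

text \<open>Count the pairs of \<open>z \<in> T\<close> and \<open>k < a\<close> with
  \<open>P (rotate k z)\<close>. Each \<open>z\<close> occurs once; each \<open>k\<close>
  contributes the number of tuples with \<open>P\<close>, because \<open>rotate k\<close> permutes
  \<open>T\<close>.\<close>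

lemma card_rotation_transversal:
  assumes "finite T" and rot: "\<And>z k. z \<in> T \<Longrightarrow> rotate k z \<in> T"
    and ex1: "\<And>z. z \<in> T \<Longrightarrow> \<exists>!k. k < a \<and> P (rotate k z)"
  shows "card T = a * card {z \<in> T. P z}"
proof -
  have bij: "bij_betw (rotate k) T T" for k
  proof -
    have inverse: "rotate (k * length x - k) (rotate k x) = x" for x :: "'a list"
    proof (cases "x = []")
      case False
      hence "k * length x - k + k = k * length x" by (cases x) simp_all
      thus ?thesis by (simp only: rotate_rotate) (simp add: rotate_id)
    qed simp
    have "inj (rotate k :: 'a list \<Rightarrow> 'a list)"
      by (rule injI) (metis inverse length_rotate)
    hence "inj_on (rotate k) T" by (rule inj_on_subset) simp
    moreover from this have "rotate k ` T = T"
      using rot by (intro endo_inj_surj assms) auto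
    ultimately show ?thesis by (simp add: bij_betw_def)
  qed
  have "card T = (\<Sum>z\<in>T. card {k\<in>{..<a}. P (rotate k z)})"
  proof -
    have "card {k\<in>{..<a}. P (rotate k z)} = 1" if "z \<in> T" for z
      using ex1[OF that] by (auto simp: card_1_singleton_iff)
    thus ?thesis by simp
  qed
  also have "\<dots> = (\<Sum>k<a. card {z \<in> T. P (rotate k z)})"
    using assms(1) by (intro sum_multicount_gen) auto
  also have "\<dots> = (\<Sum>k<a. card {z \<in> T. P z})"
  proof (rule sum.cong)
    fix k
    have "bij_betw (rotate k) {z \<in> T. P (rotate k z)} {z \<in> T. P z}"
      using bij[of k] by (auto simp: bij_betw_def inj_on_def)
    thus "card {z \<in> T. P (rotate k z)} = card {z \<in> T. P z}"
      by (rule bij_betw_same_card)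
  qed simp
  finally show ?thesis by simp
qed

text \<open>No nonempty initial segment of the periodic extension has a mean above that of the whole
  tuple, stated without division.\<close>

definition ballot :: "nat list \<Rightarrow> bool" where
  "ballot z \<longleftrightarrow> (\<forall>j. length z * psum z j \<le> j * psum z (length z))"

text \<open>The cycle lemma: the ballot rotation starts where the height \<open>D\<close> is minimal, and this place
  is unique because the values of \<open>D\<close> on a period are distinct modulo the length.\<close>

lemma ex1_ballot_rotate:
  assumes "z \<noteq> []" and cop: "coprime (length z) (psum z (length z))"
  shows "\<exists>!k. k < length z \<and> ballot (rotate k z)"
proof -
  define a c where "a = length z" and "c = psum z a"
  have "0 < a" using assms by (simp add: a_def)
  define D where "D k = int k * int c - int a * int (psum z k)" for k
  have D_mult: "D (k + t * a) = D k" for k t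
    using psum_add_mult_length[of z k t] by (simp add: D_def a_def c_def algebra_simps)
  have D_mod: "D (k mod a) = D k" for k
    using D_mult[of "k mod a" "k div a"] by simp
  have psum_rot: "psum z (k + j) = psum z k + psum (rotate k z) j" for k j
    using psum_rotate assms(1) by blast
  have ballot: "ballot (rotate k z) \<longleftrightarrow> (\<forall>i. D k \<le> D i)" for k
  proof -
    have "psum (rotate k z) a = c"
      using psum_rot[of k a] psum_add_length[of z k] by (simp add: a_def c_def)
    moreover have "a * psum (rotate k z) j \<le> j * c \<longleftrightarrow> D k \<le> D (k + j)" for j
    proof -
      have "a * psum (rotate k z) j \<le> j * c \<longleftrightarrow> int a * int (psum (rotate k z) j) \<le> int j * int c"
        by (simp flip: of_nat_mult)
      also have "\<dots> \<longleftrightarrow> D k \<le> D (k + j)"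
        unfolding D_def psum_rot[of k j] by (simp add: algebra_simps)
      finally show ?thesis .
    qed
    ultimately have "ballot (rotate k z) \<longleftrightarrow> (\<forall>j. D k \<le> D (k + j))"
      by (simp add: ballot_def a_def)
    also have "\<dots> \<longleftrightarrow> (\<forall>i. D k \<le> D i)"
    proof (intro iffI allI)
      fix i assume *: "\<forall>j. D k \<le> D (k + j)"
      \<comment> \<open>Adding \<open>k\<close> periods moves \<open>i\<close> past \<open>k\<close>
        and leaves \<open>D\<close> unchanged.\<close>
      have "k \<le> i + k * a" using \<open>0 < a\<close> by (simp add: trans_le_add2)
      hence "D k \<le> D (i + k * a)" using * by (metis le_add_diff_inverse)
      thus "D k \<le> D i" by (simp add: D_mult)
    qed blast
    finally show ?thesis .
  qed
  have "finite (D ` {..<a})" "D ` {..<a} \<noteq> {}" using \<open>0 < a\<close> by auto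
  hence "Min (D ` {..<a}) \<in> D ` {..<a}" by (rule Min_in)
  then obtain k where k: "k < a" "Min (D ` {..<a}) = D k" by auto
  hence "D k \<le> D (j mod a)" for j
    using \<open>0 < a\<close> by (metis Min_le \<open>finite (D ` {..<a})\<close> imageI lessThan_iff mod_less_divisor)
  hence "\<forall>j. D k \<le> D j" by (simp add: D_mod)
  with k(1) have "k < a \<and> ballot (rotate k z)" by (simp add: ballot)
  moreover have "k' = k" if "k' < a" "k < a" "ballot (rotate k' z)" "ballot (rotate k z)" for k k'
  proof -
    have "D k = D k'" using that by (simp add: ballot order_antisym)
    hence "int k * int c - int k' * int c = int a * (int (psum z k) - int (psum z k'))"
      by (simp add: D_def algebra_simps)
    hence "[int k * int c = int k' * int c] (mod int a)"
      by (simp add: cong_iff_dvd_diff)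
    hence "[k * c = k' * c] (mod a)" by (simp flip: cong_int_iff)
    hence "[k = k'] (mod a)"
      using cop by (simp add: cong_mult_rcancel_nat a_def c_def coprime_commute)
    thus ?thesis using that by (simp add: cong_def)
  qed
  ultimately show ?thesis unfolding a_def by blast
qed

text \<open>Rotation by \<open>k\<close> lowers the weight of every entry by \<open>k\<close> modulo
  the length. The term for this stands on the left to avoid subtraction of naturals.\<close>

lemma cong_weighted_sum_rotate:
  assumes "z \<noteq> []"
  shows "[(\<Sum>m<length z. m * rotate k z ! m) + k * psum z (length z) = (\<Sum>m<length z. m * z ! m)]
    (mod length z)"
proof -
  define a where "a = length z"
  have "0 < a" using assms by (simp add: a_def)
  let ?h = "\<lambda>m. (k + m) mod a"
  have inj: "inj_on ?h {..<a}"
    by (rule inj_onI) (metis cong_add_lcancel_nat cong_def lessThan_iff mod_less)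
  have "?h ` {..<a} = {..<a}"
    by (intro endo_inj_surj inj) (use \<open>0 < a\<close> in auto)
  with inj have bij: "bij_betw ?h {..<a} {..<a}"
    by (simp add: bij_betw_def)
  have nth: "rotate k z ! m = z ! ?h m" if "m < a" for m
    using that by (simp add: nth_rotate a_def)
  have "psum z a = (\<Sum>m<a. rotate k z ! m)"
    using sum.reindex_bij_betw[OF bij, of "(!) z"] psum_length[of z] by (simp add: nth a_def)
  hence "(\<Sum>m<a. m * rotate k z ! m) + k * psum z a = (\<Sum>m<a. (k + m) * rotate k z ! m)"
    by (simp add: sum_distrib_left sum.distrib algebra_simps)
  also have "[\<dots> = (\<Sum>m<a. ?h m * rotate k z ! m)] (mod a)"
    by (intro cong_sum cong_mult) (simp_all add: cong_def)
  also have "(\<Sum>m<a. ?h m * rotate k z ! m) = (\<Sum>m<a. m * z ! m)"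
    using sum.reindex_bij_betw[OF bij, of "\<lambda>m. m * z ! m"] by (simp add: nth)
  finally show ?thesis unfolding a_def .
qed

lemma ex_cong_mult:
  fixes a c w :: nat
  assumes "0 < a" "coprime a c"
  shows "\<exists>k<a. [k * c = w] (mod a)"
proof -
  obtain x where "[c * x = Suc 0] (mod a)"
    using cong_solve_coprime_nat[of c a] assms by (auto simp: coprime_commute)
  hence "[c * x * w = Suc 0 * w] (mod a)" by (intro cong_mult cong_refl)
  moreover have "[x * w mod a * c = x * w * c] (mod a)"
    by (simp add: cong_def mod_mult_left_eq)
  ultimately have "[x * w mod a * c = w] (mod a)"
    by (metis cong_trans mult.assoc mult.commute mult_Suc mult_0 add_0_right)
  thus ?thesis using assms(1) mod_less_divisor by blast
qed

text \<open>Divisibility for the rotation by \<open>k\<close> is a linear congruence in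
  \<open>k\<close>, whose coefficient is invertible modulo the length by coprimality.\<close>

lemma ex1_dvd_weighted_sum_rotate:
  assumes "z \<noteq> []" and cop: "coprime (length z) (psum z (length z))"
  shows "\<exists>!k. k < length z \<and> length z dvd (\<Sum>m<length z. m * rotate k z ! m)"
proof -
  define a c where "a = length z" and "c = psum z a"
  let ?w = "\<lambda>z. \<Sum>m<a. m * z ! m :: nat"
  have "0 < a" using assms by (simp add: a_def)
  have dvd: "a dvd ?w (rotate k z) \<longleftrightarrow> [k * c = ?w z] (mod a)" for k
  proof -
    have eq: "[?w (rotate k z) + k * c = ?w z] (mod a)"
      using cong_weighted_sum_rotate[OF assms(1), of k] by (simp add: a_def c_def)
    have "a dvd ?w (rotate k z) \<longleftrightarrow> [?w (rotate k z) + k * c = 0 + k * c] (mod a)"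
      by (simp only: cong_add_rcancel_nat cong_0_iff)
    also have "\<dots> \<longleftrightarrow> [k * c = ?w z] (mod a)"
      using eq unfolding cong_def by (auto simp only: add_0)
    finally show ?thesis .
  qed
  obtain k where "k < a" "[k * c = ?w z] (mod a)"
    using ex_cong_mult[OF \<open>0 < a\<close>, of c] cop by (auto simp: a_def c_def)
  moreover have "k = k'"
    if "k < a" "k' < a" "[k * c = ?w z] (mod a)" "[k' * c = ?w z] (mod a)" for k k'
  proof -
    have "[k * c = k' * c] (mod a)" using that by (metis cong_sym cong_trans)
    hence "[k = k'] (mod a)"
      using cop by (simp add: cong_mult_rcancel_nat a_def c_def coprime_commute)
    thus ?thesis using that by (simp add: cong_def)
  qed
  ultimately show ?thesis unfolding dvd[folded a_def] a_def[symmetric] by blast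
qed

section \<open>Gap sets and ballot tuples\<close>

text \<open>This is the least element \<open>y\<^sub>j\<close> of the gap set belonging to
  \<open>z\<close>, and the height in the cycle lemma. The subtraction is exact for ballot
  tuples.\<close>

definition level :: "nat list \<Rightarrow> nat \<Rightarrow> nat" where
  "level z j = j * psum z (length z) - length z * psum z j"

lemma level_plus: "ballot z \<Longrightarrow> level z j + length z * psum z j = j * psum z (length z)"
  by (simp add: level_def ballot_def)

lemma level_0 [simp]: "level z 0 = 0"
  by (simp add: level_def)

lemma level_add_mult_length: "level z (j + t * length z) = level z j"
  unfolding level_def psum_add_mult_length by (simp add: algebra_simps)

lemma level_mod: "level z (j mod length z) = level z j"
  using level_add_mult_length[of z "j mod length z" "j div length z"] by simp

lemma level_Suc:
  assumes "ballot z"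
  shows "level z (Suc j) + length z * z ! (j mod length z) = level z j + psum z (length z)"
  using level_plus[OF assms, of j] level_plus[OF assms, of "Suc j"] by (simp add: algebra_simps)

definition level_set :: "nat list \<Rightarrow> nat set" where
  "level_set z = {level z j + length z * t | j t. True}"

text \<open>By coprimality, a level in the class of \<open>j\<close> has an index congruent to
  \<open>j\<close>, hence equals \<open>level z j\<close>; all else in this class lies above it.
  Thus the set determines the levels.\<close>

lemma Least_level_set:
  assumes "ballot z" and cop: "coprime (length z) (psum z (length z))"
  shows "(LEAST x. x \<in> level_set z \<and> [x = j * psum z (length z)] (mod length z)) = level z j"
proof -
  define a c where "a = length z" and "c = psum z a"
  have cong: "[level z j = j * c] (mod a)" for j
    using level_plus[OF assms(1), of j] unfolding a_def[symmetric] c_def[symmetric]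
    by (metis cong_def mod_mult_self2)
  show ?thesis
    unfolding a_def[symmetric] c_def[symmetric]
  proof (rule Least_equality)
    have "level z j = level z j + length z * 0" by simp
    hence "level z j \<in> level_set z" unfolding level_set_def by blast
    with cong show "level z j \<in> level_set z \<and> [level z j = j * c] (mod a)" by simp
  next
    fix x assume x: "x \<in> level_set z \<and> [x = j * c] (mod a)"
    then obtain i t where it: "x = level z i + a * t"
      by (auto simp: level_set_def a_def)
    have "[x = level z i] (mod a)" by (simp add: it cong_def)
    hence "[i * c = j * c] (mod a)"
      using cong[of i] x by (metis cong_sym cong_trans)
    hence "[i = j] (mod a)"
      using cop by (simp add: cong_mult_rcancel_nat a_def c_def coprime_commute)
    hence "i mod a = j mod a" by (simp add: cong_def)
    hence "level z i = level z j"
      by (metis a_def level_mod)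
    thus "level z j \<le> x" by (simp add: it)
  qed
qed

text \<open>Modulo \<open>a\<close>, \<open>b i\<close> is the negative of \<open>b 0 * l i\<close>,
  so adding it leads from the class of \<open>(j + l i) * b 0\<close> to that of
  \<open>j * b 0\<close>. Closure under \<open>b i\<close> thus compares two least elements, whose
  difference is governed by a sum of \<open>l i\<close> consecutive entries.\<close>

lemma bij_betw_level_set:
  assumes "0 < a" and cop: "coprime a (b 0)"
    and dvd: "\<forall>i\<in>{1..n}. a dvd b 0 * l i + b i"
  shows "bij_betw level_set {z \<in> bounded_tuples a n b l. ballot z}
    {K. 0 \<in> K \<and> finite (- K) \<and> (\<forall>s\<in>insert a (b ` {0..n}). \<forall>g\<in>K. g + s \<in> K)}"
    (is "bij_betw _ ?T ?R")
proof (rule bij_betw_imageI)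
  define c where "c = b 0"
  have T: "length z = a" "psum z a = c" "ballot z" "psum z (length z) = c"
    "\<And>i j. i \<in> {1..n} \<Longrightarrow> a * psum z (j + l i) \<le> a * psum z j + c * l i + b i"
    if "z \<in> ?T" for z
    using that bounded_tuples_iff[OF assms(1), of z n b l] by (auto simp: c_def)
  have Least: "(LEAST x. x \<in> level_set z \<and> [x = j * c] (mod a)) = level z j" if "z \<in> ?T" for z j
    using Least_level_set[of z j] T(1-4)[OF that] cop by (simp add: c_def)
  show "inj_on level_set ?T"
  proof (rule inj_onI)
    fix z z' assume z: "z \<in> ?T" "z' \<in> ?T" and "level_set z = level_set z'"
    hence level: "level z j = level z' j" for j
      using Least by metis
    show "z = z'"
    proof (rule nth_equalityI)
      fix j assume "j < length z"
      hence "j < a" using T(1) z by simp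
      \<comment> \<open>Consecutive levels determine the entry between them.\<close>
      have "level y (Suc j) + a * y ! j = level y j + c" if "y \<in> ?T" for y
        using level_Suc[OF T(3)[OF that], of j] T(1,4)[OF that] \<open>j < a\<close> by simp
      from this[OF z(1)] this[OF z(2)] have "a * z ! j = a * z' ! j"
        unfolding level by linarith
      thus "z ! j = z' ! j" using assms(1) by simp
    qed (use T(1) z in simp)
  qed
  show "level_set ` ?T = ?R"
  proof
    have "level_set z \<in> ?R" if z: "z \<in> ?T" for z
    proof -
      note Tz = T[OF z]
      have mem: "x \<in> level_set z \<longleftrightarrow> (\<exists>j t. x = level z j + a * t)" for x
        using Tz(1-4) by (auto simp: level_set_def)
      have level: "level z j + a * psum z j = j * c" for j
        using level_plus[of z j] Tz(1-4) by simp
      have "0 = level z 0 + a * 0" by simp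
      hence 0: "0 \<in> level_set z" unfolding mem by blast
      \<comment> \<open>Each class contains a level of some index \<open>j < a\<close>, which is at
        most \<open>a * c\<close>; from there on nothing is missing.\<close>
      have "x \<in> level_set z" if "a * c \<le> x" for x
      proof -
        obtain j where j: "j < a" "[j * c = x] (mod a)"
          using ex_cong_mult[OF assms(1) cop] by (auto simp: c_def)
        have "level z j \<le> j * c" using level[of j] by linarith
        also have "\<dots> \<le> a * c" using j(1) by simp
        finally have "level z j \<le> x" using that by simp
        moreover have "[level z j = x] (mod a)"
          using j(2) level[of j] by (metis cong_def mod_mult_self2)
        ultimately have "a dvd x - level z j"
          by (metis cong_altdef_nat cong_sym)
        hence "x = level z j + a * ((x - level z j) div a)"
          using \<open>level z j \<le> x\<close> by simp
        thus ?thesis unfolding mem by blast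
      qed
      hence "- level_set z \<subseteq> {..<a * c}" by (meson ComplD lessThan_iff not_le subsetI)
      hence fin: "finite (- level_set z)" by (rule finite_subset) simp
      have closed_a: "g + a \<in> level_set z" if g: "g \<in> level_set z" for g
      proof -
        obtain j t where "g = level z j + a * t" using g mem by blast
        hence "g + a = level z j + a * Suc t" by simp
        thus ?thesis unfolding mem by blast
      qed
      have closed_c: "g + c \<in> level_set z" if g: "g \<in> level_set z" for g
      proof -
        obtain j t where "g = level z j + a * t" using g mem by blast
        hence "g + c = level z (Suc j) + a * (z ! (j mod a) + t)"
          using level_Suc[of z j] Tz(1-4) by (simp add: algebra_simps)
        thus ?thesis unfolding mem by blast
      qed
      have closed_b: "g + b i \<in> level_set z" if g: "g \<in> level_set z" and i: "i \<in> {1..n}" for g i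
      proof -
        obtain j t where g_eq: "g = level z j + a * t" using g mem by blast
        \<comment> \<open>This index stands for \<open>j - l i\<close> modulo \<open>a\<close> while
          staying a natural number.\<close>
        define k where "k = j + (a - 1) * l i"
        have k: "k + l i = j + l i * a"
          using assms(1) by (cases a) (simp_all add: k_def algebra_simps)
        obtain q where q: "c * l i + b i = a * q"
          using bspec[OF dvd i] unfolding c_def dvd_def by blast
        have "a * psum z (k + l i) \<le> a * (psum z k + q)"
          using Tz(5)[OF i, of k] q by (simp add: algebra_simps)
        hence "psum z (k + l i) \<le> psum z k + q" using assms(1) by simp
        then obtain d where d: "psum z k + q = psum z (k + l i) + d" by (metis le_Suc_ex)
        have "level z (k + l i) = level z j"
          unfolding k using level_add_mult_length[of z j "l i"] Tz(1-4) by simp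
        hence "level z j + b i + a * psum z (k + l i) = level z k + a * (psum z k + q)"
          using level[of "k + l i"] level[of k] q by (simp add: algebra_simps)
        hence "g + b i = level z k + a * (d + t)"
          unfolding d by (simp add: g_eq distrib_left)
        thus ?thesis unfolding mem by blast
      qed
      have "{0..n} = insert 0 {1..n}" by auto
      with 0 fin closed_a closed_b closed_c show ?thesis
        by (auto simp: c_def)
    qed
    thus "level_set ` ?T \<subseteq> ?R" by blast
    show "?R \<subseteq> level_set ` ?T"
    proof
      fix K assume "K \<in> ?R"
      hence K0: "0 \<in> K" and Ka: "\<And>g. g \<in> K \<Longrightarrow> g + a \<in> K" and Kc: "\<And>g. g \<in> K \<Longrightarrow> g + c \<in> K"
        and Kb: "\<And>g i. i \<in> {1..n} \<Longrightarrow> g \<in> K \<Longrightarrow> g + b i \<in> K"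
        by (auto simp: c_def)
      have Kat: "g + a * t \<in> K" if "g \<in> K" for g t
      proof (induction t)
        case (Suc t)
        thus ?case using Ka[of "g + a * t"] by (simp add: algebra_simps)
      qed (use that in simp)
      define w where "w j = (LEAST x. x \<in> K \<and> [x = j * c] (mod a))" for j
      \<comment> \<open>This element shows that the class meets \<open>K\<close>, so that the least
        element \<open>w j\<close> exists.\<close>
      have "j * c \<in> K" for j
      proof (induction j)
        case (Suc j)
        thus ?case using Kc[of "j * c"] by (simp add: add.commute)
      qed (use K0 in simp)
      hence "w j \<in> K \<and> [w j = j * c] (mod a)" for j
        using LeastI[of "\<lambda>x. x \<in> K \<and> [x = j * c] (mod a)" "j * c"] by (simp add: w_def)
      hence wK: "w j \<in> K" and w_cong: "[w j = j * c] (mod a)" for j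
        by blast+
      have w_le: "w j \<le> x" if "x \<in> K" "[x = j * c] (mod a)" for x j
        unfolding w_def using that by (intro Least_le) simp
      have w0: "w 0 = 0"
        using w_le[of 0 0] K0 by simp
      have w_period: "w (j + a) = w j" for j
      proof -
        have "[x = (j + a) * c] (mod a) \<longleftrightarrow> [x = j * c] (mod a)" for x
          by (simp add: cong_def distrib_right)
        thus ?thesis by (simp add: w_def)
      qed
      have w_mod: "w (j mod a) = w j \<and> w (Suc (j mod a)) = w (Suc j)" for j
      proof -
        have "w (i + t * a) = w i" for i t
        proof (induction t)
          case (Suc t)
          thus ?case using w_period[of "i + t * a"] by (simp add: algebra_simps)
        qed simp
        from this[of "j mod a" "j div a"] this[of "Suc (j mod a)" "j div a"]
        show ?thesis by simp
      qed
      \<comment> \<open>\<open>w j + c\<close> lies in \<open>K\<close> and in the class of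
        \<open>w (Suc j)\<close>, so it exceeds that minimum by a multiple of \<open>a\<close>. The
        quotient is the entry of \<open>z\<close> at \<open>j\<close>.\<close>
      have step: "\<exists>q. w j + c = w (Suc j) + a * q" for j
      proof -
        have cong: "[w j + c = Suc j * c] (mod a)"
          using cong_add[OF w_cong[of j] cong_refl[of c]] by (simp add: add.commute)
        with Kc[OF wK] have "w (Suc j) \<le> w j + c" by (rule w_le)
        moreover have "[w (Suc j) = w j + c] (mod a)"
          using cong w_cong by (metis cong_sym cong_trans)
        ultimately have "a dvd w j + c - w (Suc j)" by (metis cong_altdef_nat cong_sym)
        with \<open>w (Suc j) \<le> w j + c\<close> show ?thesis by (metis dvdE le_add_diff_inverse)
      qed
      define z where "z = map (\<lambda>j. (w j + c - w (Suc j)) div a) [0..<a]"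
      have len: "length z = a" by (simp add: z_def)
      have z_nth: "a * z ! (j mod a) + w (Suc j) = w j + c" for j
      proof -
        have "z ! (j mod a) = (w j + c - w (Suc j)) div a"
          using assms(1) w_mod by (simp add: z_def)
        thus ?thesis using step[of j] assms(1) by auto
      qed
      have w_psum: "a * psum z j + w j = j * c" for j
      proof (induction j)
        case (Suc j)
        thus ?case using z_nth[of j] by (simp add: len distrib_left)
      qed (simp add: w0)
      have "a * psum z a = a * c"
        using w_psum[of a] w_period[of 0] w0 by simp
      hence psum_a: "psum z a = c" using assms(1) by simp
      \<comment> \<open>The ballot condition is the nonnegativity of \<open>w j\<close>.\<close>
      have "a * psum z j \<le> j * c" for j
        using w_psum[of j] by linarith
      hence ballot: "ballot z" by (simp add: ballot_def len psum_a)
      have "a * psum z (j + l i) \<le> a * psum z j + c * l i + b i" if i: "i \<in> {1..n}" for i j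
      proof -
        have "[w (j + l i) + b i = (j + l i) * c + b i] (mod a)"
          by (intro cong_add w_cong cong_refl)
        also have "(j + l i) * c + b i = j * c + (b 0 * l i + b i)"
          by (simp add: c_def algebra_simps)
        also have "[\<dots> = j * c + 0] (mod a)"
          using bspec[OF dvd i] by (intro cong_add cong_refl) (simp add: cong_0_iff)
        finally have "[w (j + l i) + b i = j * c] (mod a)" by simp
        with Kb[OF i wK] have "w j \<le> w (j + l i) + b i" by (rule w_le)
        thus ?thesis
          using w_psum[of j] w_psum[of "j + l i"] by (simp add: algebra_simps)
      qed
      hence "z \<in> ?T"
        using ballot len psum_a by (simp add: bounded_tuples_iff[OF assms(1)] c_def)
      moreover have "level_set z = K"
      proof -
        have level: "level z j = w j" for j
          using w_psum[of j] by (simp add: level_def len psum_a)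
        \<comment> \<open>By coprimality every residue class is that of some \<open>j * c\<close>,
          so each element of \<open>K\<close> lies a multiple of \<open>a\<close> above some
          \<open>w j\<close>.\<close>
        have "\<exists>j t. x = w j + a * t" if "x \<in> K" for x
        proof -
          obtain j where j: "[j * c = x] (mod a)"
            using ex_cong_mult[OF assms(1) cop] by (auto simp: c_def)
          have "w j \<le> x" "[w j = x] (mod a)"
            using w_le[OF that cong_sym[OF j]] cong_trans[OF w_cong j] by simp_all
          hence "a dvd x - w j" by (metis cong_altdef_nat cong_sym)
          with \<open>w j \<le> x\<close> show ?thesis by (metis dvdE le_add_diff_inverse)
        qed
        thus ?thesis
          using Kat wK by (auto simp: level_set_def level len)
      qed
      ultimately show "K \<in> level_set ` ?T" by blast
    qed
  qed
qed

section \<open>Comparison of the two counts\<close>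

text \<open>Cores correspond explicitly to ballot tuples. Tuples with the divisibility condition are
  only shown to be equally many, as either number times \<open>a\<close> counts all bounded tuples;
  the bijection then comes from equality of finite cardinalities.\<close>

theorem theorem5p4:
  fixes n a :: nat and b l :: "nat \<Rightarrow> nat"
  assumes "2 \<le> a"
    and "\<forall>i\<in>{0..n}. 0 < b i \<and> \<not> a dvd b i"
    and "coprime a (b 0)"
    and "\<forall>i\<in>{1..n}. 1 \<le> l i \<and> l i \<le> a - 1 \<and> a dvd b 0 * l i + b i"
  shows "(\<exists>f. bij_betw f (core_partitions (insert a (b ` {0..n})))
               {z \<in> bounded_tuples a n b l. a dvd (\<Sum>m<a. m * z ! m)})
    \<and> finite (core_partitions (insert a (b ` {0..n})))
    \<and> real (card (core_partitions (insert a (b ` {0..n}))))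
        = 1 / real a * real (card (bounded_tuples a n b l))"
proof -
  let ?C = "core_partitions (insert a (b ` {0..n}))"
  let ?T = "bounded_tuples a n b l"
  let ?K = "{K. 0 \<in> K \<and> finite (- K) \<and> (\<forall>s\<in>insert a (b ` {0..n}). \<forall>g\<in>K. g + s \<in> K)}"
  have "0 < a" using assms(1) by simp
  have "0 \<notin> insert a (b ` {0..n})"
    using assms(1,2) by (metis image_iff insert_iff less_irrefl \<open>0 < a\<close>)
  hence bij_C: "bij_betw (\<lambda>p. - first_column_hooks p) ?C ?K"
    by (rule bij_betw_core_partitions)
  have bij_T: "bij_betw level_set {z \<in> ?T. ballot z} ?K"
    using assms(3,4) by (intro bij_betw_level_set \<open>0 < a\<close>) auto
  have card_C: "card ?C = card {z \<in> ?T. ballot z}"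
    using bij_betw_same_card[OF bij_C] bij_betw_same_card[OF bij_T] by (rule trans[OF _ sym])
  have "finite ?C \<longleftrightarrow> finite {z \<in> ?T. ballot z}"
    using bij_betw_finite[OF bij_C] bij_betw_finite[OF bij_T] by (rule trans[OF _ sym])
  have T: "z \<noteq> [] \<and> length z = a \<and> coprime (length z) (psum z (length z))" if "z \<in> ?T" for z
    using that assms(3) \<open>0 < a\<close> by (auto simp: bounded_tuples_iff)
  note transversal = card_rotation_transversal[OF finite_bounded_tuples rotate_in_bounded_tuples[OF \<open>0 < a\<close>]]
  have card_ballot: "card ?T = a * card {z \<in> ?T. ballot z}"
    using ex1_ballot_rotate T by (intro transversal) metis+
  have card_dvd: "card ?T = a * card {z \<in> ?T. a dvd (\<Sum>m<a. m * z ! m)}"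
    using ex1_dvd_weighted_sum_rotate T by (intro transversal) metis+
  have "finite ?C"
    using \<open>finite ?C \<longleftrightarrow> _\<close> finite_bounded_tuples by simp
  moreover have "card ?C = card {z \<in> ?T. a dvd (\<Sum>m<a. m * z ! m)}"
    using card_C card_ballot card_dvd \<open>0 < a\<close> by simp
  hence "\<exists>f. bij_betw f ?C {z \<in> ?T. a dvd (\<Sum>m<a. m * z ! m)}"
    using \<open>finite ?C\<close> finite_bounded_tuples by (intro finite_same_card_bij) auto
  moreover have "real (card ?C) = 1 / real a * real (card ?T)"
    using card_C card_ballot \<open>0 < a\<close> by simp
  ultimately show ?thesis by blast
qed

end
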